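(* Let $3\leq n\leq m$. Then $$C_{M_n,M_m}(z) = C_{M_m,M_n}(z) = \sum_{b\in B_n\cap B_m} z^{|b|-1}.$$
   Context: Finite Fibonacci words: $f_1=1$, $f_2=0$, $f_{n+2}=f_{n+1}f_n$. For $n\geq 3$, $p_n$ is $f_n$ with its last two letters deleted ($p_3=\epsilon$, $p_4=0$, ...). The minimal forbidden factors of the infinite Fibonacci word are $M_{2n+1}=1p_{2n+1}1$ and $M_{2n+2}=0p_{2n+2}0$ for $n\geq 1$. A word $b$ is a border of $w$ if $w=xb=by$ for some words $x,y$; for $n\geq 3$, $B_n$ is the set of nonempty borders of $M_n$. Words are indexed from $0$. For $u$ of length $n$ and $v$ of length $m$, the correlation $C_{u,v}$ is the binary word of length $n$ with $C_{u,v}[k]=1$ iff $u[i]=v[j]$ for all $0\le i<n$, $0\le j<m$ with $i=j+k$ (and $0$ otherwise); its correlation polynomial is $C_{u,v}(z)=\sum_{k=0}^{n-1}C_{u,v}[k]z^{n-1-k}$. *)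

theory Defs
  imports "HOL-Computational_Algebra.Polynomial"
begin

text \<open>Words are lists, and the letters 0 and 1 are natural numbers.\<close>

(* Words are numbered from 1; the value at 0 is a dummy. *)
fun fib_word :: "nat \<Rightarrow> nat list" where
  "fib_word 0 = []"
| "fib_word (Suc 0) = [1]"
| "fib_word (Suc (Suc 0)) = [0]"
| "fib_word (Suc (Suc (Suc n))) = fib_word (Suc (Suc n)) @ fib_word (Suc n)"

(* Meaningful for n \<ge> 3, where fib_word n has at least two letters. *)
definition fib_central :: "nat \<Rightarrow> nat list" where
  "fib_central n = butlast (butlast (fib_word n))"

(* For n \<ge> 3, the n-th minimal forbidden factor of the infinite Fibonacci word:
   the letter n mod 2 put around the central word. *)
definition min_forbidden :: "nat \<Rightarrow> nat list" where
  "min_forbidden n = (if odd n then [1] @ fib_central n @ [1] else [0] @ fib_central n @ [0])"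

(* A word is a border of itself, and so is the empty word. *)
definition is_border :: "'a list \<Rightarrow> 'a list \<Rightarrow> bool" where
  "is_border b w \<longleftrightarrow> (\<exists>x y. w = x @ b \<and> w = b @ y)"

definition borders :: "nat \<Rightarrow> nat list set" where
  "borders n = {b. b \<noteq> [] \<and> is_border b (min_forbidden n)}"

definition correlation :: "'a list \<Rightarrow> 'a list \<Rightarrow> nat list" where
  "correlation u v =
     map (\<lambda>k. if \<forall>i<length u. \<forall>j<length v. i = j + k \<longrightarrow> u ! i = v ! j then 1 else 0)
       [0..<length u]"

definition correlation_poly :: "'a list \<Rightarrow> 'a list \<Rightarrow> int poly" where
  "correlation_poly u v =
     (\<Sum>k<length u. monom (int (correlation u v ! k)) (length u - 1 - k))"

(* Sums over sets of borders range over finite sets. *)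
lemma finite_borders: "finite (borders n)"
proof -
  have "borders n \<subseteq> (\<lambda>k. take k (min_forbidden n)) ` {..length (min_forbidden n)}"
  proof
    fix b assume "b \<in> borders n"
    then obtain y where "min_forbidden n = b @ y"
      by (auto simp: borders_def is_border_def)
    then show "b \<in> (\<lambda>k. take k (min_forbidden n)) ` {..length (min_forbidden n)}"
      by (intro image_eqI[where x = "length b"]) auto
  qed
  then show ?thesis by (rule finite_subset) simp
qed

end

theory Submission
  imports Defs "HOL-Library.Sublist"
begin

text \<open>
  The Fibonacci words are the iterates of the morphism \<open>0 \<mapsto> 01\<close>, \<open>1 \<mapsto> 0\<close>, and the central words
  satisfy \<open>p\<^sub>n\<^sub>+\<^sub>1 = \<phi>(p\<^sub>n) 0\<close>; hence each \<open>p\<^sub>n\<close> is a palindrome and a prefix of all later ones.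
  A proper factor of \<open>M\<^sub>m\<close> is, up to reversal, a factor of some Fibonacci word, whereas desubstituting
  \<open>\<phi>\<close> shows that no \<open>M\<^sub>n\<close> is one. So \<open>M\<^sub>n\<close> does not occur in \<open>M\<^sub>m\<close> for \<open>n < m\<close>, and each overlap of the
  two words is a suffix of one that is a prefix of the other. Such an overlap is a palindrome,
  since stripping its end letters leaves a border of \<open>p\<^sub>n\<close>; being a palindrome, it is a border of
  both \<open>M\<^sub>n\<close> and \<open>M\<^sub>m\<close>.
\<close>

section \<open>The Fibonacci morphism\<close>

definition fib_morph :: "nat list \<Rightarrow> nat list" where
  "fib_morph w = concat (map (\<lambda>c. if c = 0 then [0, 1] else [0]) w)"

lemma fib_morph_simps [simp]:
  "fib_morph [] = []"
  "fib_morph (c # w) = (if c = 0 then [0, 1] else [0]) @ fib_morph w"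
  "fib_morph (u @ v) = fib_morph u @ fib_morph v"
  by (simp_all add: fib_morph_def)

lemma fib_morph_eq_Nil_iff [simp]: "fib_morph w = [] \<longleftrightarrow> w = []"
  by (cases w) auto

lemma fib_morph_hd: "fib_morph w = c # z \<Longrightarrow> c = 0"
  by (cases w) (auto split: if_splits)

text \<open>Each \<open>fib_morph [c] @ [0]\<close> is a palindrome, 010 or 00, so the trailing 0
  can be passed through the images one by one.\<close>

lemma rev_fib_morph: "rev (fib_morph w @ [0]) = fib_morph (rev w) @ [0]"
proof (induction w)
  case (Cons c w)
  then show ?case by auto
qed simp

text \<open>A 1 arises only as the second letter of the image of 0.\<close>

lemma fib_morph_one_preceded:
  "fib_morph w = x @ 1 # z \<Longrightarrow> \<exists>x'. x = x' @ [0]"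
proof (induction w arbitrary: x)
  case (Cons c w)
  consider "x = []" | "x = [0]" | d x' where "x = 0 # d # x'"
    using Cons.prems by (cases x rule: list.exhaust; cases "tl x") (auto split: if_splits)
  then show ?case
  proof cases
    case 3
    show ?thesis
    proof (cases "c = 0")
      case True
      then have "d = 1" "fib_morph w = x' @ 1 # z" using Cons.prems 3 by auto
      then show ?thesis using Cons.IH[of x'] 3 by auto
    next
      case False
      then have "fib_morph w = (d # x') @ 1 # z" using Cons.prems 3 by auto
      then show ?thesis using Cons.IH[of "d # x'"] 3 by auto
    qed
  qed (use Cons.prems in \<open>auto split: if_splits\<close>)
qed simp

text \<open>Decoding from the left: every image begins with 0, and whether a 1 follows reveals the
  letter. Only a final letter 1 of \<open>u\<close> is ambiguous, as a 1 at the head of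
  \<open>y\<close> would turn its image into that of 0; the last hypothesis excludes this.\<close>

lemma fib_morph_prefixD:
  assumes "fib_morph w = fib_morph u @ y"
    and "set u \<subseteq> {0, 1}" "set w \<subseteq> {0, 1}"
    and "u \<noteq> [] \<Longrightarrow> last u = 1 \<Longrightarrow> y = [] \<or> hd y = 0"
  shows "prefix u w"
  using assms
proof (induction u arbitrary: w)
  case (Cons a u)
  then obtain b w' where w: "w = b # w'" by (cases w) (auto split: if_splits)
  have IH: "prefix u w'" if "fib_morph w' = fib_morph u @ y"
    using Cons.IH[OF that] Cons.prems(2-4) w by auto
  have a: "a = 0 \<or> a = 1" and b: "b = 0 \<or> b = 1" using Cons.prems w by auto
  show ?case
  proof (cases "a = b")
    case True
    then show ?thesis using IH w Cons.prems(1) by (auto split: if_splits)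
  next
    case False
    then consider "a = 0" "b = 1" | "a = 1" "b = 0" using a b by auto
    then show ?thesis
    proof cases
      case 1
      then have "fib_morph w' = 1 # fib_morph u @ y" using Cons.prems(1) w by auto
      then show ?thesis using fib_morph_hd by fastforce
    next
      case 2
      then have *: "fib_morph u @ y = 1 # fib_morph w'" using Cons.prems(1) w by auto
      show ?thesis
      proof (cases "u = []")
        case True
        then show ?thesis using * Cons.prems(4) 2 by auto
      next
        case False
        then obtain c z where "fib_morph u = c # z" by (cases "fib_morph u") auto
        then show ?thesis using * fib_morph_hd by fastforce
      qed
    qed
  qed
qed simp

lemma fib_morph_sublistD:
  assumes "fib_morph w = x @ fib_morph u @ y"
    and "set u \<subseteq> {0, 1}" "set w \<subseteq> {0, 1}" "u \<noteq> []"
    and "last u = 1 \<Longrightarrow> y = [] \<or> hd y = 0"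
  shows "sublist u w"
  using assms
proof (induction w arbitrary: x)
  case (Cons b w)
  have IH: "sublist u w" if "fib_morph w = x' @ fib_morph u @ y" for x'
    using Cons.IH[OF that] Cons.prems(2-5) by auto
  obtain z where z: "fib_morph u = 0 # z"
    using \<open>u \<noteq> []\<close> by (metis fib_morph_eq_Nil_iff fib_morph_hd neq_Nil_conv)
  show ?case
  proof (cases x)
    case Nil
    then show ?thesis
      using fib_morph_prefixD[of "b # w" u y] Cons.prems by auto
  next
    case (Cons d x')
    have "\<exists>x''. fib_morph w = x'' @ fib_morph u @ y"
    proof (cases "b = 0")
      case True
      then have *: "1 # fib_morph w = x' @ fib_morph u @ y"
        using Cons.prems(1) Cons by auto
      \<comment> \<open>Since \<open>fib_morph u\<close> begins with 0, the occurrence cannot start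
        inside an image 01.\<close>
      then show ?thesis using z by (cases x') auto
    next
      case False
      then show ?thesis using Cons.prems(1) Cons by auto
    qed
    then show ?thesis using IH by (auto simp: sublist_Cons_right)
  qed
qed simp

section \<open>Fibonacci words and central words\<close>

lemma fib_word_morph: "fib_word (Suc (Suc n)) = fib_morph (fib_word (Suc n))"
proof (induction n rule: induct_nat_012)
  case (ge2 n)
  have "fib_morph (fib_word (Suc (Suc (Suc n)))) =
      fib_morph (fib_word (Suc (Suc n))) @ fib_morph (fib_word (Suc n))" by simp
  also have "\<dots> = fib_word (Suc (Suc (Suc n))) @ fib_word (Suc (Suc n))"
    by (simp only: ge2)
  finally show ?case by simp
qed auto

lemma set_fib_word: "set (fib_word n) \<subseteq> {0, 1}"
  by (induction n rule: fib_word.induct) auto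

lemma fib_word_Suc_ge3: "3 \<le> n \<Longrightarrow> fib_word (Suc n) = fib_morph (fib_word n)"
  using fib_word_morph[of "n - 1"] by simp

text \<open>The morphism turns the endings 01 and 10 into 010 and 001: the first 0 joins the central
  word, and the last two letters swap.\<close>

lemma fib_word_eq_central:
  "3 \<le> n \<Longrightarrow> fib_word n = fib_central n @ [Suc n mod 2, n mod 2]"
proof (induction n rule: nat_induct_at_least)
  case base
  have "fib_word 3 = [0, 1]" by (simp add: eval_nat_numeral)
  then show ?case by (simp add: fib_central_def)
next
  case (Suc n)
  have "fib_word (Suc n) = fib_morph (fib_central n) @ [0, Suc (Suc n) mod 2, Suc n mod 2]"
    using fib_word_Suc_ge3[OF Suc.hyps] Suc.IH by (cases "even n") (auto simp: mod2_eq_if)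
  then show ?case by (simp add: fib_central_def butlast_append)
qed

lemma fib_central_Suc:
  assumes "3 \<le> n"
  shows "fib_central (Suc n) = fib_morph (fib_central n) @ [0]"
proof -
  have "fib_word (Suc n) = fib_morph (fib_central n) @ [0, Suc (Suc n) mod 2, Suc n mod 2]"
    using fib_word_Suc_ge3[OF assms] fib_word_eq_central[OF assms]
    by (cases "even n") (auto simp: mod2_eq_if)
  then show ?thesis by (simp add: fib_central_def butlast_append)
qed

lemma fib_central_3: "fib_central 3 = []"
  by (simp add: fib_central_def numeral_eq_Suc)

lemma rev_fib_central: "3 \<le> n \<Longrightarrow> rev (fib_central n) = fib_central n"
proof (induction n rule: nat_induct_at_least)
  case base
  show ?case by (simp add: fib_central_3)
next
  case (Suc n)
  then show ?case using rev_fib_morph[of "fib_central n"] by (simp add: fib_central_Suc)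
qed

lemma strict_prefix_fib_central_Suc:
  "3 \<le> n \<Longrightarrow> strict_prefix (fib_central n) (fib_central (Suc n))"
proof (induction n rule: nat_induct_at_least)
  case base
  show ?case using fib_central_Suc[of 3] by (simp add: fib_central_3)
next
  case (Suc n)
  then obtain c z where "fib_central (Suc n) = fib_central n @ c # z"
    by (auto elim: strict_prefixE')
  \<comment> \<open>The image of \<open>c\<close> begins with 0, which supplies the closing 0 of
    \<open>fib_central (Suc n)\<close>; the final \<open>[0]\<close> makes the prefix
    strict.\<close>
  then have "fib_central (Suc (Suc n)) =
      (fib_morph (fib_central n) @ [0]) @ (if c = 0 then [1] else []) @ fib_morph z @ [0]"
    using Suc.hyps by (simp add: fib_central_Suc)
  then show ?case unfolding fib_central_Suc[OF Suc.hyps]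
    by (metis append_is_Nil_conv not_Cons_self2 prefix_order.le_less same_prefix_nil prefixI)
qed

lemma prefix_fib_central:
  assumes "3 \<le> n" "n \<le> m"
  shows "prefix (fib_central n) (fib_central m)"
  using assms(2)
proof (induction m rule: dec_induct)
  case (step m)
  then show ?case
    using strict_prefix_fib_central_Suc[of m] assms(1)
    by (meson le_trans prefix_order.less_imp_le prefix_order.trans)
qed simp

lemma length_fib_central_less:
  assumes "3 \<le> n" "n < m"
  shows "length (fib_central n) < length (fib_central m)"
proof -
  have "strict_prefix (fib_central n) (fib_central m)"
    using strict_prefix_fib_central_Suc[OF assms(1)] prefix_fib_central[of "Suc n" m] assms
    by (meson Suc_leI le_SucI prefix_order.less_le_trans)
  then show ?thesis by (rule prefix_length_less)
qed

section \<open>Minimal forbidden factors\<close>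

lemma min_forbidden_eq: "min_forbidden n = (n mod 2) # fib_central n @ [n mod 2]"
  by (simp add: min_forbidden_def mod2_eq_if)

lemma length_min_forbidden: "length (min_forbidden n) = length (fib_central n) + 2"
  by (simp add: min_forbidden_eq)

lemma rev_min_forbidden: "3 \<le> n \<Longrightarrow> rev (min_forbidden n) = min_forbidden n"
  by (simp add: min_forbidden_eq rev_fib_central)

lemma set_min_forbidden: "3 \<le> n \<Longrightarrow> set (min_forbidden n) \<subseteq> {0, 1}"
  using set_fib_word[of n] fib_word_eq_central[of n] by (auto simp: min_forbidden_eq)

text \<open>Up to one 0 at an end, the morphism maps each forbidden word to the next, so occurrences
  can be desubstituted.\<close>

lemma fib_morph_min_forbidden:
  assumes "3 \<le> n"
  shows "even n \<Longrightarrow> fib_morph (min_forbidden n) = 0 # min_forbidden (Suc n)"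
    and "odd n \<Longrightarrow> fib_morph (min_forbidden n) @ [0] = min_forbidden (Suc n)"
  using assms by (auto simp: min_forbidden_eq fib_central_Suc mod2_eq_if)

text \<open>Here \<open>k\<close> is arbitrary because an occurrence is pulled back to the preceding
  Fibonacci word. The base word 11 fails since every 1 in an image is preceded by 0.\<close>

lemma min_forbidden_not_sublist_fib_word:
  "3 \<le> n \<Longrightarrow> \<not> sublist (min_forbidden n) (fib_word k)"
proof (induction n arbitrary: k rule: nat_induct_at_least)
  case base
  show ?case
  proof
    assume "sublist (min_forbidden 3) (fib_word k)"
    then obtain x y where xy: "fib_word k = x @ 1 # 1 # y"
      by (auto simp: sublist_def min_forbidden_eq fib_central_3)
    then obtain j where "k = Suc (Suc j)"
      by (cases k rule: fib_word.cases) (auto simp: Cons_eq_append_conv)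
    then have "fib_morph (fib_word (Suc j)) = (x @ [1]) @ 1 # y"
      using xy fib_word_morph by simp
    from fib_morph_one_preceded[OF this] show False by simp
  qed
next
  case (Suc n)
  show ?case
  proof
    assume "sublist (min_forbidden (Suc n)) (fib_word k)"
    then obtain x y where xy: "fib_word k = x @ min_forbidden (Suc n) @ y"
      by (auto simp: sublist_def)
    then have "length (fib_word k) \<ge> 2" by (simp add: length_min_forbidden)
    then obtain j where "k = Suc (Suc j)" by (cases k rule: fib_word.cases) auto
    then have w: "fib_morph (fib_word (Suc j)) = x @ min_forbidden (Suc n) @ y"
      using xy fib_word_morph by simp
    have "sublist (min_forbidden n) (fib_word (Suc j))"
    proof (cases "even n")
      case True
      \<comment> \<open>The forbidden word starts with 1 here; the 0 before it completes the image
        of the first letter of \<open>min_forbidden n\<close>.\<close>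
      then have "\<exists>x'. x = x' @ [0]"
        using w by (intro fib_morph_one_preceded) (auto simp: min_forbidden_eq mod2_eq_if)
      then obtain x' where "x = x' @ [0]" ..
      then have "fib_morph (fib_word (Suc j)) = x' @ fib_morph (min_forbidden n) @ y"
        using w fib_morph_min_forbidden(1)[OF Suc.hyps True] by simp
      then show ?thesis
        by (rule fib_morph_sublistD)
          (use True set_fib_word set_min_forbidden[OF Suc.hyps]
            in \<open>auto simp: min_forbidden_eq mod2_eq_if\<close>)
    next
      case False
      \<comment> \<open>The last 0 is moved into the remainder, which thereby meets the side
        condition for the final letter 1 of \<open>min_forbidden n\<close>.\<close>
      then have "fib_morph (fib_word (Suc j)) = x @ fib_morph (min_forbidden n) @ 0 # y"
        using w by (simp flip: fib_morph_min_forbidden(2)[OF Suc.hyps False])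
      then show ?thesis
        by (rule fib_morph_sublistD)
          (use set_fib_word set_min_forbidden[OF Suc.hyps] in \<open>auto simp: min_forbidden_eq\<close>)
    qed
    then show False using Suc.IH by blast
  qed
qed

text \<open>This covers \<open>min_forbidden m\<close> without its first letter. The second extra
  letter carries the induction: for odd \<open>m\<close> the first one is 1, whose image 0 only
  completes the next central word.\<close>

lemma sublist_central_fib_word:
  "3 \<le> m \<Longrightarrow> sublist (fib_central m @ [m mod 2, Suc m mod 2]) (fib_word (Suc m))"
proof (induction m rule: nat_induct_at_least)
  case base
  have "fib_word (Suc 3) = [0] @ [1, 0]" by (simp add: numeral_eq_Suc)
  then show ?case unfolding fib_central_3 sublist_def
    by (intro exI[of _ "[0]"] exI[of _ "[]"]) simp
next
  case (Suc m)
  then obtain x y where "fib_word (Suc m) = x @ (fib_central m @ [m mod 2, Suc m mod 2]) @ y"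
    by (auto simp: sublist_def)
  then have "fib_word (Suc (Suc m)) =
      fib_morph x @ (fib_central (Suc m) @ [Suc m mod 2, Suc (Suc m) mod 2]) @ fib_morph y"
    using fib_word_morph[of m] Suc.hyps
    by (cases "even m") (auto simp: fib_central_Suc mod2_eq_if)
  then show ?case by (auto simp: sublist_def)
qed

lemma min_forbidden_not_sublist:
  assumes "3 \<le> n" "n < m"
  shows "\<not> sublist (min_forbidden n) (min_forbidden m)"
proof
  let ?a = "m mod 2"
  have m: "3 \<le> m" using assms by simp
  have no: "\<not> sublist (min_forbidden n) (fib_central m @ [?a])"
  proof
    assume "sublist (min_forbidden n) (fib_central m @ [?a])"
    moreover have "sublist (fib_central m @ [?a]) (fib_central m @ [?a, Suc m mod 2])"
      by (rule prefix_imp_sublist) simp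
    ultimately show False
      using sublist_central_fib_word[OF m] min_forbidden_not_sublist_fib_word[OF assms(1)]
      by (meson sublist_order.order.trans)
  qed
  assume "sublist (min_forbidden n) (min_forbidden m)"
  then consider "prefix (min_forbidden n) (?a # fib_central m @ [?a])"
    | "sublist (min_forbidden n) (fib_central m @ [?a])"
    by (auto simp: min_forbidden_eq[of m] sublist_Cons_right)
  then show False
  proof cases
    case 1
    \<comment> \<open>A shorter prefix misses the last letter; by palindromicity, reversal gives an
      occurrence that misses the first.\<close>
    have "length (min_forbidden n) < length (?a # fib_central m @ [?a])"
      using length_fib_central_less[OF assms] by (simp add: length_min_forbidden)
    with 1 have "prefix (min_forbidden n) ((?a # fib_central m) @ [?a])"
      "min_forbidden n \<noteq> (?a # fib_central m) @ [?a]" by auto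
    then have "prefix (min_forbidden n) (?a # fib_central m)"
      by (simp only: prefix_snoc) blast
    then have "suffix (rev (min_forbidden n)) (rev (?a # fib_central m))"
      by (simp only: suffix_to_prefix rev_rev_ident)
    then have "suffix (min_forbidden n) (fib_central m @ [?a])"
      using rev_min_forbidden[OF assms(1)] rev_fib_central[OF m] by simp
    then show ?thesis using no by (blast dest: suffix_imp_sublist)
  qed (use no in blast)
qed

text \<open>Unless \<open>b\<close> is short or all of \<open>min_forbidden n\<close>, write it as
  \<open>a # b' @ [c]\<close>: then \<open>rev b' @ [a]\<close> and \<open>b' @ [c]\<close> are
  prefixes of \<open>fib_central m\<close> of equal length, hence equal.\<close>

lemma min_forbidden_overlap_palindrome:
  assumes "3 \<le> n" "n \<le> m" "suffix b (min_forbidden n)" "prefix b (min_forbidden m)"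
  shows "rev b = b"
proof -
  consider "b = []" | c where "b = [c]" | a b' c where "b = a # b' @ [c]"
    by (metis neq_Nil_conv rev_exhaust)
  then show ?thesis
  proof cases
    case (3 a b' c)
    have "suffix ((a # b') @ [c]) (((n mod 2) # fib_central n) @ [n mod 2])"
      using assms(3) 3 by (simp add: min_forbidden_eq)
    then have suf: "c = n mod 2" "suffix (a # b') ((n mod 2) # fib_central n)"
      by (simp_all only: snoc_suffix_snoc)
    have pre: "prefix (b' @ [c]) (fib_central m @ [m mod 2])"
      using assms(4) 3 by (simp add: min_forbidden_eq)
    from suf(2) consider "a = n mod 2" "b' = fib_central n" | "suffix (a # b') (fib_central n)"
      by (auto simp: suffix_Cons)
    then show ?thesis
    proof cases
      case 1
      then show ?thesis using 3 suf rev_fib_central[OF assms(1)] by simp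
    next
      case 2
      have pnm: "prefix (fib_central n) (fib_central m)" using prefix_fib_central assms by blast
      have "prefix (rev (a # b')) (rev (fib_central n))"
        using 2 by (simp only: suffix_to_prefix)
      then have rp: "prefix (rev b' @ [a]) (fib_central m)"
        using pnm rev_fib_central[OF assms(1)] by (metis prefix_order.trans rev.simps(2))
      then have "length (b' @ [c]) \<le> length (fib_central m)"
        using prefix_length_le by fastforce
      then have "prefix (b' @ [c]) (fib_central m)"
        using pre by (metis length_append_singleton not_less_eq_eq order_refl prefix_snoc)
      with rp obtain s t where "(rev b' @ [a]) @ s = (b' @ [c]) @ t"
        unfolding prefix_def by metis
      then have "rev b' = b'" "a = c" by (simp_all add: append_eq_append_conv)
      then show ?thesis using 3 by simp
    qed
  qed auto
qed

section \<open>Correlation polynomials\<close>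

lemma is_border_iff: "is_border b w \<longleftrightarrow> prefix b w \<and> suffix b w"
  by (auto simp: is_border_def prefix_def suffix_def)

lemma is_border_rev:
  assumes "rev w = w" "rev b = b"
  shows "is_border b w \<longleftrightarrow> prefix b w" "is_border b w \<longleftrightarrow> suffix b w"
  using assms by (auto simp: is_border_iff suffix_to_prefix)

text \<open>Only positions present in both words are compared, so a match means that the shorter of
  \<open>drop k u\<close> and \<open>v\<close> is a prefix of the other.\<close>

lemma correlation_nth:
  assumes "k < length u"
  shows "correlation u v ! k = (if prefix (drop k u) v \<or> prefix v (drop k u) then 1 else 0)"
proof -
  have "(\<forall>i<length u. \<forall>j<length v. i = j + k \<longrightarrow> u ! i = v ! j) \<longleftrightarrow>
      (\<forall>j<min (length u - k) (length v). drop k u ! j = v ! j)"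
    using assms by (auto simp: add.commute less_diff_conv)
  also have "\<dots> \<longleftrightarrow> prefix (drop k u) v \<or> prefix v (drop k u)"
  proof (cases "length u - k \<le> length v")
    case True
    then have "prefix v (drop k u) \<Longrightarrow> prefix (drop k u) v"
      by (metis append_eq_conv_conj length_drop order_refl prefix_def take_all)
    moreover have "prefix (drop k u) v \<longleftrightarrow> (\<forall>j<length u - k. drop k u ! j = v ! j)"
      using True by (auto simp: prefix_def list_eq_iff_nth_eq nth_append
          intro!: exI[of _ "drop (length u - k) v"])
    ultimately show ?thesis using True by (auto simp: min_def)
  next
    case False
    then have "\<not> prefix (drop k u) v" by (auto dest: prefix_length_le)
    moreover have "prefix v (drop k u) \<longleftrightarrow> (\<forall>j<length v. drop k u ! j = v ! j)"
      using False by (auto simp: prefix_def list_eq_iff_nth_eq nth_append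
          intro!: exI[of _ "drop (length v) (drop k u)"])
    ultimately show ?thesis using False by (auto simp: min_def)
  qed
  finally show ?thesis using assms by (simp add: correlation_def)
qed

text \<open>The shift \<open>k\<close> corresponds to the nonempty suffix \<open>drop k u\<close>,
  whose length gives the exponent.\<close>

lemma correlation_poly_eq_sum:
  assumes "\<And>b. b \<in> B \<longleftrightarrow> b \<noteq> [] \<and> suffix b u \<and> (prefix b v \<or> prefix v b)"
  shows "correlation_poly u v = (\<Sum>b\<in>B. monom 1 (length b - 1))"
proof -
  let ?K = "{k. k < length u \<and> drop k u \<in> B}"
  have "correlation_poly u v =
      (\<Sum>k<length u. if drop k u \<in> B then monom 1 (length u - 1 - k) else 0)"
    unfolding correlation_poly_def
    by (intro sum.cong refl) (auto simp: correlation_nth assms suffix_drop)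
  also have "\<dots> = (\<Sum>k\<in>?K. monom 1 (length u - 1 - k))"
    by (simp add: sum.If_cases Int_def)
  also have "\<dots> = (\<Sum>b\<in>B. monom 1 (length b - 1))"
  proof (rule sum.reindex_bij_witness[of _ "\<lambda>b. length u - length b" "\<lambda>k. drop k u"])
    fix b assume b: "b \<in> B"
    then obtain x where x: "u = x @ b" "b \<noteq> []" using assms by (auto simp: suffix_def)
    then show "drop (length u - length b) u = b" by simp
    then show "length u - length b \<in> ?K" using x b by simp
  qed auto
  finally show ?thesis .
qed

theorem theorem4:
  fixes n m :: nat
  assumes "3 \<le> n" and "n \<le> m"
  shows "correlation_poly (min_forbidden n) (min_forbidden m)
           = correlation_poly (min_forbidden m) (min_forbidden n)
       \<and> correlation_poly (min_forbidden m) (min_forbidden n)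
           = (\<Sum>b \<in> borders n \<inter> borders m. monom 1 (length b - 1))"
proof -
  let ?N = "min_forbidden n" and ?M = "min_forbidden m" and ?B = "borders n \<inter> borders m"
  have pal: "rev ?N = ?N" "rev ?M = ?M" using assms rev_min_forbidden by auto
  have len: "length ?N \<le> length ?M"
    using prefix_length_le[OF prefix_fib_central[OF assms]] by (simp add: length_min_forbidden)
  have B: "b \<in> ?B \<longleftrightarrow> b \<noteq> [] \<and> suffix b ?N \<and> prefix b ?M" for b
    using min_forbidden_overlap_palindrome[OF assms, of b] is_border_rev[of ?N b]
      is_border_rev[of ?M b] pal
    by (auto simp: borders_def is_border_iff)
  \<comment> \<open>Reversal exchanges prefixes and suffixes of the two palindromes, so the overlap
    lemma is applied to \<open>rev b\<close>.\<close>
  have B': "b \<in> ?B \<longleftrightarrow> b \<noteq> [] \<and> suffix b ?M \<and> prefix b ?N" for b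
    using min_forbidden_overlap_palindrome[OF assms, of "rev b"] is_border_rev[of ?N b]
      is_border_rev[of ?M b] pal
    by (auto simp: borders_def is_border_iff suffix_to_prefix)
  have "correlation_poly ?N ?M = (\<Sum>b\<in>?B. monom 1 (length b - 1))"
  proof (rule correlation_poly_eq_sum)
    fix b
    have "prefix b ?M" if "suffix b ?N" "prefix ?M b"
    proof -
      have "length b = length ?M"
        using that len by (metis le_antisym le_trans prefix_length_le suffix_length_le)
      then show ?thesis using that(2) by (auto simp: prefix_def)
    qed
    then show "b \<in> ?B \<longleftrightarrow> b \<noteq> [] \<and> suffix b ?N \<and> (prefix b ?M \<or> prefix ?M b)"
      using B by blast
  qed
  moreover have "correlation_poly ?M ?N = (\<Sum>b\<in>?B. monom 1 (length b - 1))"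
  proof (rule correlation_poly_eq_sum)
    fix b
    \<comment> \<open>In this order lengths alone do not decide: \<open>?N\<close> might lie inside
      a longer \<open>?M\<close>, which \<open>min_forbidden_not_sublist\<close> rules out.\<close>
    have "prefix b ?N" if "suffix b ?M" "prefix ?N b"
    proof -
      have "sublist ?N ?M"
        using that by (meson prefix_imp_sublist suffix_imp_sublist sublist_order.order.trans)
      then have "n = m" using min_forbidden_not_sublist[OF assms(1)] assms(2)
        by (metis le_neq_implies_less)
      then have "length b = length ?N"
        using that by (metis le_antisym prefix_length_le suffix_length_le)
      then show ?thesis using that(2) by (auto simp: prefix_def)
    qed
    then show "b \<in> ?B \<longleftrightarrow> b \<noteq> [] \<and> suffix b ?M \<and> (prefix b ?N \<or> prefix ?N b)"
      using B' by blast
  qed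
  ultimately show ?thesis by simp
qed

end
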